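(* Let $n\geqslant 2$, let $q=(q_1,\ldots,q_n)$ be a probability mass function on $\{1,\ldots,n\}$, let $\varphi\in[0,1)$, and let $(r,s)$ be a maximizer of $\mathrm{H}(q-s+r)$ over all pairs of $n$-tuples with $r_k\geqslant 0$, $s_k\geqslant 0$, $q_k-s_k+r_k\geqslant 0$ for all $k$ and $\sum_k s_k=\sum_k r_k=\varphi$. Assume $s_k r_k=0$ for all $k=1,\ldots,n$. Let $i\in\{1,\ldots,n\}$ be an index satisfying $b_{i,n}=0$, and let $s',r'$ be the tuples $s,r$ cyclically reordered to start at index $i$. Let $\Delta$ be the number of time periods a message is delayed in the steady state, and let $\bar\delta=\mathrm{E}\,\Delta$. Then $$\bar{\delta} = \sum_{\delta=1}^n \delta \sum_{\substack{1\leqslant k<j\leqslant n,\; j-k=\delta,\\ r'_j>0,\; s'_k>0}} \frac{r'_j\,s'_k}{b_{i,j-1}} \prod_{l \in \omega(j,k)} \left(1- \frac{r'_l}{b_{i,l-1}}\right).$$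
   Context: Here $\mathrm{H}(t)=-\sum_k t_k\log_2 t_k$ is Shannon's entropy. For $i,j\in\{1,\ldots,n\}$ let $a_{i,j}=s_m-r_m$ where $m\in\{1,\ldots,n\}$ and $m\equiv i+j-1 \pmod n$ (so $a_i=(a_{i,1},\ldots,a_{i,n})$ is the cyclic shift of the tuple $(s_k-r_k)_{k=1}^n$ starting at position $i$). The sequence $(b_{i,j})_{j\geqslant 1}$ is defined by $b_{i,1}=\max\{a_{i,1},0\}$ and $b_{i,j}=\max\{b_{i,j-1}+a_{i,k},0\}$ for $j\geqslant 2$, where $k=j-n\lfloor\frac{j-1}{n}\rfloor$. It models the fraction of messages (relative to the total number per cycle) held in a buffer after time period $j$ when the storing strategy $s$ and forwarding strategy $r$ are applied cyclically starting at period $i$. The reordered tuples are $s'_k=s_l$, $r'_k=r_l$ with $l=i+k-1-n\lfloor\frac{i+k-2}{n}\rfloor$, for $k=1,\ldots,n$; let $q'$ denote $q$ reordered in the same way. Define $\omega(j,k)=\{l:\ r'_l>0,\ k<l<j\}$ (an empty product equals $1$). Probabilistic model (buffer output uniformly at random, within one cycle of the reordered periods $1,\ldots,n$, the buffer being empty at the start of the cycle): a message is generated at period $k$ with probability $q'_k$ and, given this, is stored in the buffer with probability $s'_k/q'_k$; otherwise it is sent immediately. Let $D\in\{0,1\}$ indicate whether the message is delayed (stored) and let $A$ be the period at which a delayed message arrives at the buffer; thus $\mathrm{P}\{D=1\}=\varphi$ and $\mathrm{P}\{D=1,A=k\}=s'_k$. At each period $l$ with $r'_l>0$, an amount $r'_l$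 is drawn uniformly at random from the current buffer content $b_{i,l-1}$; that is, a delayed message with $A<l$ that has not left the buffer before period $l$ leaves at period $l$ with conditional probability $r'_l/b_{i,l-1}$, given $A$ and given that it has not left before. Let $L$ be the period at which a delayed message leaves the buffer. Then $\Delta=L-A$ if $D=1$, and $\Delta=0$ if $D=0$. *)

theory Defs
  imports "HOL-Probability.Probability" "HOL-Number_Theory.Cong"
begin

text \<open>An \<open>n\<close>-tuple \<open>(t\<^sub>1, \<dots>, t\<^sub>n)\<close> is a function \<open>nat \<Rightarrow> real\<close> of which only the
  values on \<open>{1..n}\<close> matter. The convention \<open>0 log 0 = 0\<close> in the entropy holds automatically.\<close>

definition shannon_entropy :: "nat \<Rightarrow> (nat \<Rightarrow> real) \<Rightarrow> real" where
  "shannon_entropy n t = - (\<Sum>k=1..n. t k * log 2 (t k))"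

definition feasible :: "nat \<Rightarrow> (nat \<Rightarrow> real) \<Rightarrow> real \<Rightarrow> (nat \<Rightarrow> real) \<times> (nat \<Rightarrow> real) \<Rightarrow> bool" where
  "feasible n q \<phi> = (\<lambda>(r, s).
     (\<forall>k\<in>{1..n}. r k \<ge> 0 \<and> s k \<ge> 0 \<and> q k - s k + r k \<ge> 0) \<and>
     (\<Sum>k=1..n. s k) = \<phi> \<and> (\<Sum>k=1..n. r k) = \<phi>)"

definition entropy_maximizer ::
  "nat \<Rightarrow> (nat \<Rightarrow> real) \<Rightarrow> real \<Rightarrow> (nat \<Rightarrow> real) \<Rightarrow> (nat \<Rightarrow> real) \<Rightarrow> bool" where
  "entropy_maximizer n q \<phi> r s \<longleftrightarrow>
     is_arg_max (\<lambda>(r, s). shannon_entropy n (\<lambda>k. q k - s k + r k)) (feasible n q \<phi>) (r, s)"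

text \<open>The \<open>k\<close>-th position of the cycle that starts at \<open>i\<close>. It is used for \<open>i, k \<ge> 1\<close> only,
  where the natural-number subtractions do not truncate.\<close>

definition cyclic_index :: "nat \<Rightarrow> nat \<Rightarrow> nat \<Rightarrow> nat" where
  "cyclic_index n i k = i + k - 1 - n * ((i + k - 2) div n)"

lemma cyclic_index_unique:
  assumes "n \<ge> 1" "i \<ge> 1" "k \<ge> 1"
  shows "m \<in> {1..n} \<and> [m = i + k - 1] (mod n) \<longleftrightarrow> m = cyclic_index n i k"
proof -
  define c where "c = i + k - 2"
  have c: "i + k - 1 = Suc c" using assms by (simp add: c_def)
  have "Suc c - n * (c div n) = Suc (c mod n)"
    by (metis Suc_diff_le minus_mult_div_eq_mod times_div_less_eq_dividend)
  then have idx: "cyclic_index n i k = Suc (c mod n)"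
    unfolding cyclic_index_def c c_def .
  have cong: "[Suc (c mod n) = Suc c] (mod n)"
    by (simp add: cong_def mod_Suc_eq)
  have lt: "c mod n < n" using assms by simp
  show ?thesis
  proof
    assume m: "m \<in> {1..n} \<and> [m = i + k - 1] (mod n)"
    then obtain m' where m': "m = Suc m'" "m' < n" by (cases m) auto
    have "[m' + 1 = c + 1] (mod n)" using m m' c by simp
    then have "[m' = c] (mod n)" by (simp only: cong_add_rcancel_nat)
    then have "m' = c mod n" using m' by (simp add: cong_def)
    then show "m = cyclic_index n i k" using idx m' by simp
  next
    assume "m = cyclic_index n i k"
    then show "m \<in> {1..n} \<and> [m = i + k - 1] (mod n)"
      using idx cong lt c by (simp add: Suc_le_eq)
  qed
qed

definition reorder :: "nat \<Rightarrow> nat \<Rightarrow> (nat \<Rightarrow> real) \<Rightarrow> nat \<Rightarrow> real" where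
  "reorder n i t k = t (cyclic_index n i k)"

definition shifted_diff ::
  "nat \<Rightarrow> (nat \<Rightarrow> real) \<Rightarrow> (nat \<Rightarrow> real) \<Rightarrow> nat \<Rightarrow> nat \<Rightarrow> real" where
  "shifted_diff n s r i j = s (cyclic_index n i j) - r (cyclic_index n i j)"

text \<open>The buffer content \<open>b\<^bsub>i,j\<^esub>\<close> after period \<open>j \<ge> 1\<close>; the value at \<open>j = 0\<close> is an auxiliary
  starting point making \<open>b\<^bsub>i,1\<^esub> = max {a\<^bsub>i,1\<^esub>, 0}\<close>.\<close>

primrec buffer ::
  "nat \<Rightarrow> (nat \<Rightarrow> real) \<Rightarrow> (nat \<Rightarrow> real) \<Rightarrow> nat \<Rightarrow> nat \<Rightarrow> real" where
  "buffer n s r i 0 = 0"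
| "buffer n s r i (Suc j) =
     max (buffer n s r i j + shifted_diff n s r i (Suc j - n * ((Suc j - 1) div n))) 0"

definition output_periods :: "(nat \<Rightarrow> real) \<Rightarrow> nat \<Rightarrow> nat \<Rightarrow> nat set" where
  "output_periods r j k = {l. r l > 0 \<and> k < l \<and> l < j}"

text \<open>Random output from the buffer within one cycle. The parameters \<open>q s r\<close> are the reordered
  tuples and \<open>b\<close> is the buffer content after each period. \<open>K\<close> is the period at which the message
  is generated, \<open>D\<close> indicates whether it is stored, \<open>A\<close> and \<open>L\<close> are the periods at which a stored
  message enters and leaves the buffer (their values are irrelevant where \<open>D = 0\<close>).
  For a stored message, \<open>L \<ge> l\<close> means that it has not left before period \<open>l\<close>, and \<open>L > n\<close> that it
  is not output during the cycle; the latter is not excluded by assumption.\<close>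

locale random_output_model = prob_space M
  for M :: "'w measure" and n :: nat and q s r b :: "nat \<Rightarrow> real"
    and K D A L :: "'w \<Rightarrow> nat" +
  assumes random_variables:
      "random_variable (count_space UNIV) K" "random_variable (count_space UNIV) D"
      "random_variable (count_space UNIV) A" "random_variable (count_space UNIV) L"
    and generated: "\<And>k. k \<in> {1..n} \<Longrightarrow> \<P>(w in M. K w = k) = q k"
    and indicator: "AE w in M. D w \<in> {0, 1}"
    and stored: "\<And>k. k \<in> {1..n} \<Longrightarrow> q k > 0 \<Longrightarrow> \<P>(w in M. D w = 1 \<bar> K w = k) = s k / q k"
    and arrival: "AE w in M. D w = 1 \<longrightarrow> A w = K w"
    and departure: "AE w in M. D w = 1 \<longrightarrow> A w < L w \<and> (L w \<le> n \<longrightarrow> r (L w) > 0)"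
    and drawn: "\<And>k l. 1 \<le> k \<Longrightarrow> k < l \<Longrightarrow> l \<le> n \<Longrightarrow> r l > 0 \<Longrightarrow>
        \<P>(w in M. D w = 1 \<and> A w = k \<and> L w \<ge> l) > 0 \<Longrightarrow>
        \<P>(w in M. L w = l \<bar> D w = 1 \<and> A w = k \<and> L w \<ge> l) = r l / b (l - 1)"

definition delay :: "('w \<Rightarrow> nat) \<Rightarrow> ('w \<Rightarrow> nat) \<Rightarrow> ('w \<Rightarrow> nat) \<Rightarrow> 'w \<Rightarrow> real" where
  "delay D A L w = (if D w = 1 then real (L w) - real (A w) else 0)"

end

theory Submission imports Defs begin

text \<open>Since the increments \<open>s' k - r' k\<close> sum to \<open>0\<close> over a cycle and the buffer is empty at its end,
  the truncation at \<open>0\<close> in the buffer recursion is never active. Hence the probability that a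
  message is waiting in the buffer after period \<open>l\<close> obeys the same recursion as the buffer content
  and equals \<open>b l\<close>. In particular it vanishes for \<open>l = n\<close>, so that a stored message leaves within
  the cycle, and the expectation is a finite sum over the arrival and departure periods.\<close>

section \<open>Cyclic reordering of the periods\<close>

lemma cyclic_index_in_range:
  assumes "n \<ge> 1" "i \<ge> 1" "k \<ge> 1"
  shows "cyclic_index n i k \<in> {1..n}"
  using cyclic_index_unique[OF assms, of "cyclic_index n i k"] by simp

lemma bij_betw_cyclic_index:
  assumes "n \<ge> 1" "i \<ge> 1"
  shows "bij_betw (cyclic_index n i) {1..n} {1..n}"
proof -
  have "inj_on (cyclic_index n i) {1..n}"
  proof (rule inj_onI)
    fix k l assume kl: "k \<in> {1..n}" "l \<in> {1..n}" "cyclic_index n i k = cyclic_index n i l"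
    have k: "[cyclic_index n i k = (i - 1) + k] (mod n)"
      using kl assms cyclic_index_unique[of n i k "cyclic_index n i k"] by simp
    have l: "[cyclic_index n i k = (i - 1) + l] (mod n)"
      using kl assms cyclic_index_unique[of n i l "cyclic_index n i k"] by simp
    have "[(i - 1) + k = (i - 1) + l] (mod n)"
      using cong_trans[OF cong_sym[OF k] l] .
    then have "[k = l] (mod n)"
      by (simp only: cong_add_lcancel_nat)
    \<comment> \<open>\<open>cyclic_index n 1\<close> is the identity on \<open>{1..n}\<close>, so
      uniqueness of the representative modulo \<open>n\<close> turns the congruence of
      \<open>k\<close> and \<open>l\<close> into equality.\<close>
    moreover have "\<And>m. m \<in> {1..n} \<Longrightarrow> m = cyclic_index n 1 m"
      using assms by (subst cyclic_index_unique[symmetric]) auto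
    moreover have "[k = l] (mod n) \<Longrightarrow> k = cyclic_index n 1 l"
      using assms kl by (subst cyclic_index_unique[symmetric]) auto
    ultimately show "k = l"
      using kl by metis
  qed
  moreover have "cyclic_index n i ` {1..n} \<subseteq> {1..n}"
    using cyclic_index_in_range[OF assms] by auto
  ultimately show ?thesis
    by (simp add: bij_betw_def endo_inj_surj)
qed

lemma sum_reorder:
  assumes "n \<ge> 1" "i \<ge> 1"
  shows "(\<Sum>k=1..n. reorder n i t k) = (\<Sum>k=1..n. t k)"
  unfolding reorder_def
  by (rule sum.reindex_bij_betw[OF bij_betw_cyclic_index[OF assms]])

text \<open>Truncation can only add to the content, so every gap is nonnegative; the gaps telescope
  to \<open>b n - b 0\<close> minus the sum of \<open>a\<close>, which is 0, so each of them
  vanishes.\<close>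

lemma truncation_inactive:
  fixes a b :: "nat \<Rightarrow> real"
  assumes "\<And>j. j < n \<Longrightarrow> b (Suc j) = max (b j + a (Suc j)) 0"
    and "b n = b 0" and "(\<Sum>k=1..n. a k) = 0" and "j < n"
  shows "b (Suc j) = b j + a (Suc j)"
proof -
  let ?gap = "\<lambda>j. b (Suc j) - b j - a (Suc j)"
  have "(\<Sum>j<n. a (Suc j)) = (\<Sum>k=1..n. a k)"
    by (simp add: sum.atLeast1_atMost_eq)
  then have "(\<Sum>j<n. ?gap j) = 0"
    using assms(2,3) sum_lessThan_telescope[of b n]
    by (simp add: sum_subtractf)
  moreover have "\<And>j. j \<in> {..<n} \<Longrightarrow> 0 \<le> ?gap j"
    using assms(1) by simp
  ultimately have "?gap j = 0"
    using assms(4) sum_nonneg_eq_0_iff[of "{..<n}" ?gap] by simp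
  then show ?thesis by simp
qed

text \<open>Collects what the probabilistic argument needs from the strategies.
  \<open>r_le_b\<close> also forces \<open>r (Suc l) = 0\<close> when \<open>b l = 0\<close>, which
  controls division by zero.\<close>

locale balanced_output_model = random_output_model +
  assumes s_bounds: "\<And>k. k \<in> {1..n} \<Longrightarrow> 0 \<le> s k \<and> s k \<le> q k"
    and r_nonneg: "\<And>k. k \<in> {1..n} \<Longrightarrow> 0 \<le> r k"
    and q_sum: "(\<Sum>k=1..n. q k) = 1"
    and b_0: "b 0 = 0"
    and b_n: "b n = 0"
    and b_Suc: "\<And>l. l < n \<Longrightarrow> b (Suc l) = b l + s (Suc l) - r (Suc l)"
    and r_le_b: "\<And>l. l < n \<Longrightarrow> r (Suc l) \<le> b l"
begin

declare random_variables [measurable]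

section \<open>Waiting and departure probabilities\<close>

definition waiting :: "nat \<Rightarrow> nat \<Rightarrow> real" where
  "waiting k l = \<P>(w in M. D w = 1 \<and> A w = k \<and> L w \<ge> l)"

definition leaving :: "nat \<Rightarrow> nat \<Rightarrow> real" where
  "leaving k l = \<P>(w in M. D w = 1 \<and> A w = k \<and> L w = l)"

lemma waiting_nonneg: "waiting k l \<ge> 0"
  by (simp add: waiting_def)

lemma prob_stored:
  assumes k: "k \<in> {1..n}"
  shows "\<P>(w in M. D w = 1 \<and> K w = k) = s k"
proof (cases "q k > 0")
  case True
  then show ?thesis
    using stored[OF k True] generated[OF k] by (simp add: cond_prob_def)
next
  case False
  \<comment> \<open>\<open>stored\<close> is silent about this case, but the event is contained in a
    null event.\<close>
  then have "q k = 0" "s k = 0" using s_bounds[OF k] by auto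
  moreover have "\<P>(w in M. D w = 1 \<and> K w = k) \<le> \<P>(w in M. K w = k)"
    by (rule finite_measure_mono) auto
  ultimately show ?thesis
    using generated[OF k] by (simp add: measure_le_0_iff)
qed

text \<open>Almost surely a stored message has \<open>A = K\<close> and \<open>L > A\<close>, so the
  bound on \<open>L\<close> excludes nothing.\<close>

lemma waiting_Suc_self:
  assumes k: "k \<in> {1..n}"
  shows "waiting k (Suc k) = s k"
proof -
  have "waiting k (Suc k) = \<P>(w in M. D w = 1 \<and> K w = k)"
    unfolding waiting_def
  proof (rule finite_measure_eq_AE)
    show "AE w in M. w \<in> {w \<in> space M. D w = 1 \<and> A w = k \<and> Suc k \<le> L w} \<longleftrightarrow>
        w \<in> {w \<in> space M. D w = 1 \<and> K w = k}"
      using arrival departure by eventually_elim auto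
  qed measurable
  then show ?thesis using prob_stored[OF k] by simp
qed

text \<open>\<open>drawn\<close> settles the case of positive \<open>r l\<close> and positive
  \<open>waiting k l\<close>. Otherwise both sides are 0: \<open>leaving\<close> is at most
  \<open>waiting\<close>, and \<open>departure\<close> rules out leaving where \<open>r\<close>
  vanishes.\<close>

lemma leaving_eq:
  assumes "1 \<le> k" "k < l" "l \<le> n"
  shows "leaving k l = waiting k l * (r l / b (l - 1))"
proof (cases "r l > 0")
  case True
  have "leaving k l = \<P>(w in M. L w = l \<and> D w = 1 \<and> A w = k \<and> L w \<ge> l)"
    unfolding leaving_def by (rule arg_cong[where f = prob]) auto
  moreover have "\<dots> \<le> waiting k l"
    unfolding waiting_def by (rule finite_measure_mono) auto
  ultimately show ?thesis
    using drawn[OF assms True] waiting_nonneg[of k l]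
    by (cases "waiting k l = 0")
      (auto simp: cond_prob_def waiting_def field_simps measure_le_0_iff zero_less_measure_iff)
next
  case False
  then have r: "r l = 0" using r_nonneg[of l] assms by auto
  have "leaving k l = prob {}"
    unfolding leaving_def
  proof (rule finite_measure_eq_AE)
    show "AE w in M. w \<in> {w \<in> space M. D w = 1 \<and> A w = k \<and> L w = l} \<longleftrightarrow> w \<in> {}"
      using departure by eventually_elim (use r assms in auto)
  qed measurable
  then show ?thesis using r by simp
qed

lemma waiting_split: "waiting k l = leaving k l + waiting k (Suc l)"
proof -
  have "waiting k l = prob ({w \<in> space M. D w = 1 \<and> A w = k \<and> L w = l} \<union>
      {w \<in> space M. D w = 1 \<and> A w = k \<and> L w \<ge> Suc l})"
    unfolding waiting_def by (rule arg_cong[where f = prob]) auto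
  also have "\<dots> = leaving k l + waiting k (Suc l)"
    unfolding waiting_def leaving_def by (rule finite_measure_Union) (measurable, auto)
  finally show ?thesis .
qed

lemma waiting_Suc:
  assumes "1 \<le> k" "k < l" "l \<le> n"
  shows "waiting k (Suc l) = waiting k l * (1 - r l / b (l - 1))"
  using waiting_split[of k l] leaving_eq[OF assms] by (simp add: algebra_simps)

text \<open>Iterates \<open>waiting_Suc\<close> from the arrival onwards; a period with
  \<open>r l = 0\<close> contributes the factor 1, so only output periods remain.\<close>

lemma waiting_eq_prod:
  assumes "1 \<le> k" "Suc k \<le> l" "l \<le> Suc n"
  shows "waiting k l = s k * (\<Prod>m\<in>output_periods r l k. 1 - r m / b (m - 1))"
  using assms(2,3)
proof (induction l rule: dec_induct)
  case base
  have "output_periods r (Suc k) k = {}"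
    by (auto simp: output_periods_def)
  then show ?case
    using assms waiting_Suc_self[of k] by simp
next
  case (step l)
  have fin: "finite (output_periods r l k)"
    by (rule finite_subset[of _ "{..l}"]) (auto simp: output_periods_def)
  have "output_periods r (Suc l) k =
      (if r l > 0 then insert l (output_periods r l k) else output_periods r l k)"
    using step.hyps by (auto simp: output_periods_def less_Suc_eq)
  moreover have "l \<notin> output_periods r l k"
    by (simp add: output_periods_def)
  moreover have "\<not> r l > 0 \<Longrightarrow> r l = 0"
    using r_nonneg[of l] step by auto
  ultimately show ?case
    using step waiting_Suc[of k l] assms(1) fin by (auto simp: mult_ac)
qed

text \<open>The conditional probability of leaving does not depend on the arrival period
  \<open>k\<close>, so the whole sum is scaled by one factor and then gains the newly stored
  mass.\<close>

lemma buffer_eq_waiting: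
  assumes "l \<le> n"
  shows "b l = (\<Sum>k=1..l. waiting k (Suc l))"
  using assms
proof (induction l)
  case 0
  then show ?case by (simp add: b_0)
next
  case (Suc l)
  have "(\<Sum>k=1..Suc l. waiting k (Suc (Suc l))) =
      (\<Sum>k=1..l. waiting k (Suc l) * (1 - r (Suc l) / b l)) + s (Suc l)"
    using Suc.prems waiting_Suc_self[of "Suc l"] waiting_Suc[of _ "Suc l"] by simp
  also have "\<dots> = b l * (1 - r (Suc l) / b l) + s (Suc l)"
    using Suc by (simp add: sum_distrib_right)
  \<comment> \<open>If \<open>b l = 0\<close>, the quotient is 0 by convention and
    \<open>r (Suc l) = 0\<close>, so the recursion still matches.\<close>
  also have "\<dots> = b (Suc l)"
    using b_Suc[of l] r_le_b[of l] r_nonneg[of "Suc l"] Suc.prems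
    by (cases "b l = 0") (auto simp: right_diff_distrib)
  finally show ?case by simp
qed

text \<open>The nonnegative numbers \<open>waiting k (Suc n)\<close> sum to \<open>b n = 0\<close>,
  so each is 0; and \<open>K\<close> lies in the cycle almost surely because \<open>q\<close> has
  total mass 1.\<close>

lemma AE_leaves_within_cycle: "AE w in M. D w = 1 \<longrightarrow> 1 \<le> A w \<and> A w < L w \<and> L w \<le> n"
proof -
  have "\<P>(w in M. K w \<in> {1..n}) = (\<Sum>k=1..n. \<P>(w in M. K w = k))"
    by (rule prob_sum) auto
  then have "\<P>(w in M. K w \<in> {1..n}) = 1"
    using generated q_sum by simp
  then have K: "AE w in M. K w \<in> {1..n}"
    by (subst (asm) prob_Collect_eq_1) auto
  have "AE w in M. \<not> (D w = 1 \<and> A w = k \<and> L w \<ge> Suc n)" if "k \<in> {1..n}" for k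
  proof -
    have "waiting k (Suc n) = 0"
      using buffer_eq_waiting[of n] b_n that waiting_nonneg
        sum_nonneg_eq_0_iff[of "{1..n}" "\<lambda>k. waiting k (Suc n)"] by simp
    then show ?thesis
      unfolding waiting_def by (subst (asm) prob_Collect_eq_0) auto
  qed
  then have "AE w in M. \<forall>k\<in>{1..n}. \<not> (D w = 1 \<and> A w = k \<and> L w \<ge> Suc n)"
    by (intro AE_finite_allI) auto
  with K arrival departure show ?thesis
    by eventually_elim (auto simp: not_less_eq_eq)
qed

section \<open>Expected delay\<close>

lemma expectation_delay:
  "expectation (delay D A L) =
    (\<Sum>(k, j) \<in> {(k, j). 1 \<le> k \<and> k < j \<and> j \<le> n}. real (j - k) * leaving k j)"
proof -
  let ?S = "{(k, j). 1 \<le> k \<and> k < j \<and> j \<le> n}"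
  let ?E = "\<lambda>(k, j). {w \<in> space M. D w = 1 \<and> A w = k \<and> L w = j}"
  let ?f = "\<lambda>w. \<Sum>p\<in>?S. real (snd p - fst p) * indicator (?E p) w"
  have fin: "finite ?S"
    by (rule finite_subset[of _ "{..n} \<times> {..n}"]) auto
  have [measurable]: "?E p \<in> events" for p
    by (cases p) simp
  have E_space: "?E p \<inter> space M = ?E p" for p
    by auto
  have eq: "AE w in M. delay D A L w = ?f w"
    using AE_leaves_within_cycle AE_space
  proof eventually_elim
    case (elim w)
    \<comment> \<open>Only the pair \<open>(A w, L w)\<close> can contribute; if \<open>D w\<close>
      is not 1, every term and the delay itself vanish.\<close>
    have "?f w = (\<Sum>p\<in>?S. if p = (A w, L w) then delay D A L w else 0)"
      using elim by (intro sum.cong) (auto simp: delay_def indicator_def of_nat_diff)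
    also have "\<dots> = delay D A L w"
      using elim fin by (auto simp: sum.delta delay_def)
    finally show ?case by simp
  qed
  have "expectation (delay D A L) = expectation ?f"
  proof (rule integral_cong_AE[OF _ _ eq])
    show "delay D A L \<in> borel_measurable M"
      unfolding delay_def[abs_def] by measurable
  qed measurable
  also have "\<dots> = (\<Sum>p\<in>?S. real (snd p - fst p) * prob (?E p))"
    by (subst Bochner_Integration.integral_sum)
      (auto intro!: integrable_real_mult_indicator simp: emeasure_eq_measure E_space simp del: One_nat_def)
  also have "\<dots> = (\<Sum>(k, j)\<in>?S. real (j - k) * leaving k j)"
    by (intro sum.cong) (auto simp: leaving_def)
  finally show ?thesis .
qed

lemma expectation_delay_formula:
  "expectation (delay D A L) =
    (\<Sum>\<delta>=1..n. real \<delta> *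
      (\<Sum>(k, j) \<in> {(k, j). 1 \<le> k \<and> k < j \<and> j \<le> n \<and> j - k = \<delta> \<and> r j > 0 \<and> s k > 0}.
        r j * s k / b (j - 1) *
        (\<Prod>l\<in>output_periods r j k. 1 - r l / b (l - 1))))"
proof -
  let ?S = "{(k, j). 1 \<le> k \<and> k < j \<and> j \<le> n}"
  let ?T = "\<lambda>\<delta>. {(k, j). 1 \<le> k \<and> k < j \<and> j \<le> n \<and> j - k = \<delta> \<and> r j > 0 \<and> s k > 0}"
  let ?p = "\<lambda>k j. r j * s k / b (j - 1) * (\<Prod>l\<in>output_periods r j k. 1 - r l / b (l - 1))"
  have fin: "finite ?S"
    by (rule finite_subset[of _ "{..n} \<times> {..n}"]) auto
  have p: "leaving k j = ?p k j" if "(k, j) \<in> ?S" for k j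
    using that leaving_eq[of k j] waiting_eq_prod[of k j] by simp
  have zero: "r j = 0 \<or> s k = 0" if "(k, j) \<in> ?S" "\<not> (r j > 0 \<and> s k > 0)" for k j
    using that r_nonneg[of j] s_bounds[of k] by auto
  have "expectation (delay D A L) = (\<Sum>x\<in>?S. case x of (k, j) \<Rightarrow> real (j - k) * leaving k j)"
    by (rule expectation_delay)
  \<comment> \<open>Pairs are grouped by their difference, which lies in
    \<open>{1..n}\<close>.\<close>
  also have "\<dots> = (\<Sum>\<delta>=1..n. \<Sum>x | x \<in> ?S \<and> snd x - fst x = \<delta>.
      case x of (k, j) \<Rightarrow> real (j - k) * leaving k j)"
    by (rule sum.group[symmetric]) (use fin in auto)
  also have "\<dots> = (\<Sum>\<delta>=1..n. real \<delta> * (\<Sum>(k, j)\<in>?T \<delta>. ?p k j))"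
  proof (rule sum.cong[OF refl])
    fix \<delta>
    have "(\<Sum>x | x \<in> ?S \<and> snd x - fst x = \<delta>. case x of (k, j) \<Rightarrow> real (j - k) * leaving k j) =
        (\<Sum>(k, j)\<in>?T \<delta>. real \<delta> * ?p k j)"
    \<comment> \<open>Restricting to positive \<open>r j\<close> and \<open>s k\<close> drops only
      zero terms.\<close>
    proof (rule sum.mono_neutral_cong_right)
      show "finite {x. x \<in> ?S \<and> snd x - fst x = \<delta>}" using fin by simp
      show "?T \<delta> \<subseteq> {x. x \<in> ?S \<and> snd x - fst x = \<delta>}" by auto
      show "\<forall>x\<in>{x. x \<in> ?S \<and> snd x - fst x = \<delta>} - ?T \<delta>.
          (case x of (k, j) \<Rightarrow> real (j - k) * leaving k j) = 0"
      proof
        fix x assume x: "x \<in> {x. x \<in> ?S \<and> snd x - fst x = \<delta>} - ?T \<delta>"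
        obtain k j where kj: "x = (k, j)" by fastforce
        with x have S: "(k, j) \<in> ?S" and "\<not> (r j > 0 \<and> s k > 0)" by auto
        then have "r j = 0 \<or> s k = 0" using zero by blast
        then have "?p k j = 0" by auto
        then show "(case x of (k, j) \<Rightarrow> real (j - k) * leaving k j) = 0"
          using p[OF S] kj by simp
      qed
      fix x assume "x \<in> ?T \<delta>"
      then show "(case x of (k, j) \<Rightarrow> real (j - k) * leaving k j) =
          (case x of (k, j) \<Rightarrow> real \<delta> * ?p k j)"
        using p by auto
    qed
    then show "(\<Sum>x | x \<in> ?S \<and> snd x - fst x = \<delta>. case x of (k, j) \<Rightarrow> real (j - k) * leaving k j) =
        real \<delta> * (\<Sum>(k, j)\<in>?T \<delta>. ?p k j)"
      by (simp add: sum_distrib_left case_prod_unfold)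
  qed
  finally show ?thesis .
qed

end

theorem theorem3:
  fixes n i :: nat and q r s q' r' s' b :: "nat \<Rightarrow> real" and \<phi> :: real
    and M :: "'w measure" and K D A L :: "'w \<Rightarrow> nat"
  assumes "n \<ge> 2"
    and "\<forall>k\<in>{1..n}. q k \<ge> 0" and "(\<Sum>k=1..n. q k) = 1"
    and "0 \<le> \<phi>" and "\<phi> < 1"
    and "entropy_maximizer n q \<phi> r s"
    and "\<forall>k\<in>{1..n}. s k * r k = 0"
    and "i \<in> {1..n}"
    and "b = buffer n s r i" and "b n = 0"
    and "q' = reorder n i q" and "s' = reorder n i s" and "r' = reorder n i r"
    and "random_output_model M n q' s' r' b K D A L"
  shows "prob_space.expectation M (delay D A L) =
    (\<Sum>\<delta>=1..n. real \<delta> *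
      (\<Sum>(k, j) \<in> {(k, j). 1 \<le> k \<and> k < j \<and> j \<le> n \<and> j - k = \<delta> \<and> r' j > 0 \<and> s' k > 0}.
        r' j * s' k / b (j - 1) *
        (\<Prod>l\<in>output_periods r' j k. 1 - r' l / b (l - 1))))"
proof -
  have n: "n \<ge> 1" and i: "i \<ge> 1" using assms(1,8) by auto
  have "feasible n q \<phi> (r, s)"
    using assms(6) by (simp add: entropy_maximizer_def is_arg_max_def)
  then have feas: "\<And>k. k \<in> {1..n} \<Longrightarrow> 0 \<le> r k \<and> 0 \<le> s k \<and> 0 \<le> q k - s k + r k"
    and sums: "(\<Sum>k=1..n. s k) = \<phi>" "(\<Sum>k=1..n. r k) = \<phi>"
    by (auto simp: feasible_def)
  have range: "cyclic_index n i k \<in> {1..n}" if "k \<in> {1..n}" for k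
    using cyclic_index_in_range[OF n i] that by simp
  \<comment> \<open>For \<open>le\<close>: if \<open>s\<close> is positive at a period, then
    \<open>r\<close> is 0 there and feasibility gives \<open>s \<le> q\<close>; otherwise
    \<open>q \<ge> 0\<close> suffices.\<close>
  have nonneg: "0 \<le> r' k" "0 \<le> s' k" and no_both: "s' k = 0 \<or> r' k = 0"
    and le: "s' k \<le> q' k" if "k \<in> {1..n}" for k
    using feas[OF range[OF that]] assms(2,7) range[OF that] assms(11-13)
    by (force simp: reorder_def)+
  \<comment> \<open>For \<open>j < n\<close> the quotient \<open>j div n\<close> is 0, so the
    recursion reads entry \<open>Suc j\<close>.\<close>
  have step: "b (Suc j) = max (b j + (s' (Suc j) - r' (Suc j))) 0" if "j < n" for j
    using that assms(9,12,13) by (simp add: shifted_diff_def reorder_def)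
  have "(\<Sum>k=1..n. s' k - r' k) = 0"
    using sums sum_reorder[OF n i] assms(12,13) by (simp add: sum_subtractf)
  then have b_Suc: "b (Suc j) = b j + (s' (Suc j) - r' (Suc j))" if "j < n" for j
    using truncation_inactive[of n b "\<lambda>k. s' k - r' k", OF step _ _ that] assms(9,10) by simp
  have b_nonneg: "b j \<ge> 0" for j
    using assms(9) by (cases j) auto
  \<comment> \<open>When output occurs nothing is stored, so \<open>b l - r' (Suc l)\<close> is the
    next content, which is nonnegative.\<close>
  have r_le: "r' (Suc l) \<le> b l" if "l < n" for l
    using no_both[of "Suc l"] b_Suc[OF that] b_nonneg[of l] b_nonneg[of "Suc l"] that by auto
  interpret random_output_model M n q' s' r' b K D A L by (fact assms(14))
  interpret balanced_output_model M n q' s' r' b K D A L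
  proof
    show "(\<Sum>k=1..n. q' k) = 1" using assms(3,11) sum_reorder[OF n i] by simp
  qed (use nonneg le assms(9,10) b_Suc r_le in auto)
  show ?thesis by (rule expectation_delay_formula)
qed

end
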